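(* Let $L$ be a finite distributive lattice with rank function $r$, let $\mu: L\to\mathbb{R}^+$ be log-supermodular, and let $g,h: L\to \mathbb{R}^+$ be comonotone. For $k: L\to\mathbb{R}^+$ put $E_{\mu}(k;q)=\sum_{x\in L} k(x)\,\mu(x)\,q^{r(x)}\in\mathbb{R}^+[q]$. Then $$E_{\mu}(g;q)\cdot E_{\mu}(h;q)\ \ll\ E_{\mu}(1;q)\cdot E_{\mu}(gh;q).$$ If instead $g,h$ are countermonotone, the reverse inequality $E_{\mu}(1;q)\cdot E_{\mu}(gh;q)\ll E_{\mu}(g;q)\cdot E_{\mu}(h;q)$ holds.
   Context: $\mathbb{R}^+=\{r\in\mathbb{R}: r\ge 0\}$. The rank function $r$ of a finite distributive lattice assigns to $x$ the length of any maximal chain in $[\hat 0,x]$. A function $\mu:L\to\mathbb{R}^+$ is log-supermodular if $\mu(x)\mu(y)\le \mu(x\wedge y)\mu(x\vee y)$ for all $x,y\in L$. A function $g:L\to\mathbb{R}$ is increasing if $x\le y$ implies $g(x)\le g(y)$, decreasing if $x\le y$ implies $g(x)\ge g(y)$. Two functions are comonotone if both are increasing or both are decreasing, and countermonotone if one is increasing and the other decreasing. For real polynomials, $p(q)\ll s(q)$ means $s(q)-p(q)$ has all coefficients nonnegative. $1$ denotes the constant function $1$ and $gh$ the pointwise product. *)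

theory Defs
  imports "HOL-Computational_Algebra.Polynomial"
begin

text \<open>
  A finite distributive lattice is a type of sort \<open>{finite, distrib_lattice}\<close>. Such a lattice
  has a least element, so the interval from it to \<open>x\<close> is the set \<open>{..x}\<close>.
  The length of a finite nonempty chain \<open>C\<close> is \<open>card C - 1\<close>.
\<close>

definition lattice_rank :: "'a::{finite, distrib_lattice} \<Rightarrow> nat" where
  "lattice_rank x = (THE n. \<forall>C. pred_on.maxchain {..x} (<) C \<longrightarrow> card C - 1 = n)"

definition log_supermodular :: "('a::lattice \<Rightarrow> real) \<Rightarrow> bool" where
  "log_supermodular \<mu> \<longleftrightarrow> (\<forall>x y. \<mu> x * \<mu> y \<le> \<mu> (inf x y) * \<mu> (sup x y))"

definition comonotone :: "('a::order \<Rightarrow> real) \<Rightarrow> ('a \<Rightarrow> real) \<Rightarrow> bool" where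
  "comonotone g h \<longleftrightarrow> (mono g \<and> mono h) \<or> (antimono g \<and> antimono h)"

definition countermonotone :: "('a::order \<Rightarrow> real) \<Rightarrow> ('a \<Rightarrow> real) \<Rightarrow> bool" where
  "countermonotone g h \<longleftrightarrow> (mono g \<and> antimono h) \<or> (antimono g \<and> mono h)"

definition coeff_le :: "real poly \<Rightarrow> real poly \<Rightarrow> bool"  (infix "\<lless>" 50) where
  "p \<lless> s \<longleftrightarrow> (\<forall>i. 0 \<le> coeff (s - p) i)"

definition E_poly :: "('a::{finite, distrib_lattice} \<Rightarrow> real) \<Rightarrow> ('a \<Rightarrow> real) \<Rightarrow> real poly" where
  "E_poly \<mu> k = (\<Sum>x\<in>UNIV. monom (k x * \<mu> x) (lattice_rank x))"

lemma maxchain_atMost_iff: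
  fixes x :: "'a::{finite, distrib_lattice}"
  shows "pred_on.maxchain {..x} (<) C \<longleftrightarrow>
    C \<subseteq> {..x} \<and> (\<forall>a\<in>C. \<forall>b\<in>C. a \<le> b \<or> b \<le> a) \<and>
    (\<forall>z\<le>x. (\<forall>a\<in>C. a \<le> z \<or> z \<le> a) \<longrightarrow> z \<in> C)" (is "?L \<longleftrightarrow> ?R")
proof
  assume L: ?L
  have ch: "C \<subseteq> {..x}" "\<forall>a\<in>C. \<forall>b\<in>C. a \<le> b \<or> b \<le> a"
    using L unfolding pred_on.maxchain_def pred_on.chain_def by (auto simp: less_le)
  have "z \<in> C" if z: "z \<le> x" "\<forall>a\<in>C. a \<le> z \<or> z \<le> a" for z
  proof (rule ccontr)
    assume "z \<notin> C"
    moreover have "pred_on.chain {..x} (<) (insert z C)"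
      unfolding pred_on.chain_def using ch z by (auto simp: less_le)
    ultimately show False using L unfolding pred_on.maxchain_def by blast
  qed
  with ch show ?R by blast
next
  assume R: ?R
  have "pred_on.chain {..x} (<) C"
    using R unfolding pred_on.chain_def by (auto simp: less_le)
  moreover have False if S: "pred_on.chain {..x} (<) S" "C \<subset> S" for S
  proof -
    obtain z where "z \<in> S" "z \<notin> C" using S by blast
    moreover have "z \<le> x" "\<forall>a\<in>C. a \<le> z \<or> z \<le> a"
      using S \<open>z \<in> S\<close> unfolding pred_on.chain_def by (auto simp: less_le)
    ultimately show False using R by blast
  qed
  ultimately show ?L unfolding pred_on.maxchain_def by blast
qed

lemma maxchain_atMost_insert:
  fixes x y :: "'a::{finite, distrib_lattice}"
  assumes D: "pred_on.maxchain {..y} (<) D" and "y < x" and cov: "\<And>z. y \<le> z \<Longrightarrow> z \<le> x \<Longrightarrow> z = y \<or> z = x"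
  shows "pred_on.maxchain {..x} (<) (insert x D)" "card (insert x D) = Suc (card D)"
proof -
  have D': "D \<subseteq> {..y}" "\<forall>a\<in>D. \<forall>b\<in>D. a \<le> b \<or> b \<le> a"
    "\<And>z. z \<le> y \<Longrightarrow> (\<forall>a\<in>D. a \<le> z \<or> z \<le> a) \<Longrightarrow> z \<in> D"
    using D unfolding maxchain_atMost_iff by blast+
  have yD: "y \<in> D" using D' by blast
  have "z \<in> insert x D" if z: "z \<le> x" "\<forall>a\<in>insert x D. a \<le> z \<or> z \<le> a" for z
    using cov[of z] z D'(3)[of z] yD by blast
  moreover have "insert x D \<subseteq> {..x}" using D'(1) \<open>y < x\<close> by (auto dest: order.strict_implies_order intro: order_trans)
  ultimately show "pred_on.maxchain {..x} (<) (insert x D)"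
    unfolding maxchain_atMost_iff using D'(2) by blast
  have "x \<notin> D" using D'(1) \<open>y < x\<close> by auto
  then show "card (insert x D) = Suc (card D)" by simp
qed

lemma maxchain_atMost_cases:
  fixes x :: "'a::{finite, distrib_lattice}"
  assumes C: "pred_on.maxchain {..x} (<) C" and ne: "C \<noteq> {x}"
  shows "\<exists>y D. pred_on.maxchain {..y} (<) D \<and> y < x \<and>
    (\<forall>z. y \<le> z \<longrightarrow> z \<le> x \<longrightarrow> z = y \<or> z = x) \<and> card C = Suc (card D)"
proof -
  have C': "C \<subseteq> {..x}" "\<forall>a\<in>C. \<forall>b\<in>C. a \<le> b \<or> b \<le> a"
    "\<And>z. z \<le> x \<Longrightarrow> (\<forall>a\<in>C. a \<le> z \<or> z \<le> a) \<Longrightarrow> z \<in> C"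
    using C unfolding maxchain_atMost_iff by blast+
  have xC: "x \<in> C" using C' by blast
  define D where "D = C - {x}"
  have "D \<noteq> {}" using ne xC D_def by blast
  then obtain y where y: "y \<in> D" "\<And>b. b \<in> D \<Longrightarrow> y \<le> b \<Longrightarrow> y = b"
    using finite_has_maximal[of D] by auto
  have top: "b \<le> y" if "b \<in> D" for b
    using y that C'(2) unfolding D_def by (metis DiffD1)
  have "y < x" using y(1) C'(1) unfolding D_def by (auto simp: less_le)
  have cov: "z = y \<or> z = x" if "y \<le> z" "z \<le> x" for z
  proof -
    have "z \<in> C" using C'(3)[OF \<open>z \<le> x\<close>] that top unfolding D_def by (metis DiffI order_trans singletonD)
    then show ?thesis using y(2)[of z] that unfolding D_def by auto
  qed
  have eq: "C = insert x D" using xC D_def by blast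
  have "z \<in> D" if z: "z \<le> y" "\<forall>a\<in>D. a \<le> z \<or> z \<le> a" for z
  proof -
    have "z < x" using z(1) \<open>y < x\<close> by order
    then have "z \<in> C" using C'(3)[of z] z(2) unfolding eq by auto
    with \<open>z < x\<close> show ?thesis by (auto simp: D_def)
  qed
  then have D: "pred_on.maxchain {..y} (<) D"
    unfolding maxchain_atMost_iff using top C'(2) eq by blast
  have card: "card C = Suc (card D)"
    unfolding eq by (rule maxchain_atMost_insert(2)[OF D \<open>y < x\<close>]) (rule cov)
  show ?thesis
    by (intro exI[of _ y] exI[of _ D] conjI allI impI D \<open>y < x\<close> card cov)
qed

lemma maxchain_atMost_card_eq:
  fixes x :: "'a::{finite, distrib_lattice}"
  assumes "pred_on.maxchain {..x} (<) C" "pred_on.maxchain {..x} (<) C'"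
  shows "card C = card C'"
  using assms
proof (induction "card {..x}" arbitrary: x C C' rule: less_induct)
  case less
  have IH: "card A = card B" if "y < x" "pred_on.maxchain {..y} (<) A" "pred_on.maxchain {..y} (<) B"
    for y A B
  proof -
    have "{..y} \<subset> {..x}" using \<open>y < x\<close> by auto
    then show ?thesis using less.hyps[OF psubset_card_mono that(2,3)] by simp
  qed
  have triv: "A = {x}" if "pred_on.maxchain {..x} (<) {x}" "pred_on.maxchain {..x} (<) A" for A
  proof -
    have "A \<subseteq> {x}" using that unfolding maxchain_atMost_iff by auto
    moreover have "x \<in> A" using that(2) unfolding maxchain_atMost_iff by auto
    ultimately show ?thesis by blast
  qed
  show ?case
  proof (cases "C = {x} \<or> C' = {x}")
    case True
    then have "C = C'" using triv[of C] triv[of C'] less.prems by (elim disjE) simp_all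
    then show ?thesis by simp
  next
    case False
    then have ne: "C \<noteq> {x}" "C' \<noteq> {x}" by auto
    obtain y D where y0: "pred_on.maxchain {..y} (<) D" "y < x"
      "\<forall>z. y \<le> z \<longrightarrow> z \<le> x \<longrightarrow> z = y \<or> z = x" "card C = Suc (card D)"
      using maxchain_atMost_cases[OF less.prems(1) ne(1)] by (elim exE conjE)
    note y = y0(1,2) y0(3)[rule_format] y0(4)
    obtain y' D' where y0': "pred_on.maxchain {..y'} (<) D'" "y' < x"
      "\<forall>z. y' \<le> z \<longrightarrow> z \<le> x \<longrightarrow> z = y' \<or> z = x" "card C' = Suc (card D')"
      using maxchain_atMost_cases[OF less.prems(2) ne(2)] by (elim exE conjE)
    note y' = y0'(1,2) y0'(3)[rule_format] y0'(4)
    show ?thesis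
    proof (cases "y = y'")
      case True
      then show ?thesis using IH[OF y(2) y(1)] y'(1) y(4) y'(4) by simp
    next
      case False
      define w where "w = inf y y'"
      have nle: "\<not> y \<le> y'" "\<not> y' \<le> y" using False y(2) y'(2) y(3)[of y'] y'(3)[of y] by (metis less_imp_le less_irrefl)+
      have sup: "sup y y' = x"
        using y(3)[of "sup y y'"] y(2) y'(2) nle by (metis less_le sup.bounded_iff sup_ge1 sup_ge2)
      have w: "w < y" "w < y'" unfolding w_def using nle by (metis inf_le1 inf_le2 less_le)+
      have cov: "z = w \<or> z = y" if "w \<le> z" "z \<le> y" for z
      proof -
        have "inf y (sup z y') = z"
          using that unfolding w_def by (simp add: inf_sup_distrib1 inf.absorb2 sup.absorb1)
        moreover have "sup z y' = y' \<or> sup z y' = x" using y'(3)[of "sup z y'"] that y(2) y'(2)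
          by (meson le_sup_iff less_imp_le order_trans sup_ge2)
        ultimately show ?thesis using y(2) unfolding w_def by (metis inf.absorb1 less_imp_le)
      qed
      have cov': "z = w \<or> z = y'" if "w \<le> z" "z \<le> y'" for z
      proof -
        have "inf y' (sup z y) = z"
          using that unfolding w_def by (simp add: inf_sup_distrib1 inf.absorb2 sup.absorb1 inf_commute)
        moreover have "sup z y = y \<or> sup z y = x" using y(3)[of "sup z y"] that y(2) y'(2)
          by (meson le_sup_iff less_imp_le order_trans sup_ge2)
        ultimately show ?thesis using y'(2) unfolding w_def by (metis inf.absorb1 inf_commute less_imp_le)
      qed
      obtain F where F: "pred_on.maxchain {..w} (<) F" using pred_on.Hausdorff by blast
      have "card D = Suc (card F)"
      proof -
        have "pred_on.maxchain {..y} (<) (insert y F)"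
          by (rule maxchain_atMost_insert(1)[OF F w(1)]) (rule cov)
        moreover have "card (insert y F) = Suc (card F)"
          by (rule maxchain_atMost_insert(2)[OF F w(1)]) (rule cov)
        ultimately show ?thesis using IH[OF y(2,1)] by simp
      qed
      moreover have "card D' = Suc (card F)"
      proof -
        have "pred_on.maxchain {..y'} (<) (insert y' F)"
          by (rule maxchain_atMost_insert(1)[OF F w(2)]) (rule cov')
        moreover have "card (insert y' F) = Suc (card F)"
          by (rule maxchain_atMost_insert(2)[OF F w(2)]) (rule cov')
        ultimately show ?thesis using IH[OF y'(2,1)] by simp
      qed
      ultimately show ?thesis using y(4) y'(4) by simp
    qed
  qed
qed

text \<open>The rank function is well defined: all maximal chains of \<open>{..x}\<close> have the same length.\<close>

lemma lattice_rank_eq: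
  assumes "pred_on.maxchain {..x} (<) C"
  shows "lattice_rank x = card C - 1"
  unfolding lattice_rank_def
proof (rule the_equality)
  show "\<forall>C'. pred_on.maxchain {..x} (<) C' \<longrightarrow> card C' - 1 = card C - 1"
  proof (intro allI impI)
    fix C' assume "pred_on.maxchain {..x} (<) C'"
    from maxchain_atMost_card_eq[OF this assms] show "card C' - 1 = card C - 1" by simp
  qed
  show "n = card C - 1" if "\<forall>C'. pred_on.maxchain {..x} (<) C' \<longrightarrow> card C' - 1 = n" for n
    using that[rule_format, OF assms] by (rule sym)
qed

end

theory Submission
  imports Defs
begin

text \<open>
  Twice the coefficient of \<open>q ^ d\<close> in \<open>E(1) E(gh) - E(g) E(h)\<close> is the sum of
  \<open>\<mu> x * \<mu> y * (g x - g y) * (h x - h y)\<close> over the pairs with \<open>r x + r y = d\<close>. Since \<open>r\<close> is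
  modular, these pairs are grouped by their meet \<open>u\<close> and join \<open>v\<close>, and every group is
  nonnegative on its own: ordered by the first component, the pairs with meet \<open>u\<close> and join \<open>v\<close>
  form a distributive lattice whose order is reversed in the second component. On it
  \<open>\<mu> x * \<mu> y\<close> is log-supermodular, while \<open>g x - g y\<close> and \<open>h x - h y\<close> are increasing with mean
  zero by the symmetry \<open>(x, y) \<mapsto> (y, x)\<close>, so the FKG inequality applies. FKG follows from the
  four functions theorem of Ahlswede and Daykin, using the representation of a finite
  distributive lattice by sets of join-primes; counting join-primes also gives the rank.
\<close>

section \<open>The four functions theorem\<close>

text \<open>The mixed products \<open>p = a0 * b1\<close> and \<open>q = a1 * b0\<close> are both at
  most \<open>t = c0 * d1\<close>, and \<open>p * q \<le> t * (c1 * d0)\<close>. Expanding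
  \<open>0 \<le> (t - p) * (t - q)\<close> and cancelling \<open>t > 0\<close> gives
  \<open>p + q \<le> t + c1 * d0\<close>. If \<open>t = 0\<close>, then \<open>p\<close> and
  \<open>q\<close> vanish.\<close>

lemma four_functions_two_points:
  fixes a0 a1 b0 b1 c0 c1 d0 d1 :: real
  assumes nonneg: "0 \<le> a0" "0 \<le> a1" "0 \<le> b0" "0 \<le> b1" "0 \<le> c0" "0 \<le> c1" "0 \<le> d0" "0 \<le> d1"
    and "a0 * b0 \<le> c0 * d0" "a0 * b1 \<le> c0 * d1" "a1 * b0 \<le> c0 * d1" "a1 * b1 \<le> c1 * d1"
  shows "(a0 + a1) * (b0 + b1) \<le> (c0 + c1) * (d0 + d1)"
proof (cases "c0 * d1 = 0")
  case True
  then have "a0 * b1 = 0" "a1 * b0 = 0"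
    using assms by (metis antisym mult_nonneg_nonneg)+
  moreover have "0 \<le> c1 * d0" using nonneg by simp
  ultimately show ?thesis using assms(9,12) True by (simp add: distrib_left distrib_right del: mult_eq_0_iff)
next
  case False
  define t where "t = c0 * d1"
  have t: "0 < t" using False nonneg unfolding t_def by (simp add: less_le)
  have "(a0 * b1) * (a1 * b0) \<le> (c0 * d0) * (c1 * d1)"
    using mult_mono[OF assms(9) assms(12)] nonneg by (simp add: mult_ac)
  then have prod: "(a0 * b1) * (a1 * b0) \<le> t * (c1 * d0)"
    unfolding t_def by (simp add: mult_ac)
  have "0 \<le> (t - a0 * b1) * (t - a1 * b0)"
    using assms(10,11) unfolding t_def by simp
  with prod have "t * (a0 * b1 + a1 * b0) \<le> t * (t + c1 * d0)"
    by (simp add: algebra_simps)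
  then have "a0 * b1 + a1 * b0 \<le> c0 * d1 + c1 * d0"
    using mult_left_le_imp_le[OF _ t] unfolding t_def by blast
  then show ?thesis using assms(9,12) by (simp add: distrib_left distrib_right)
qed

lemma sum_Pow_insert:
  fixes f :: "'b set \<Rightarrow> real"
  assumes "finite J" "x \<notin> J"
  shows "sum f (Pow (insert x J)) = (\<Sum>A\<in>Pow J. f A + f (insert x A))"
proof -
  have "inj_on (insert x) (Pow J)"
    using assms(2) by (intro inj_onI) (metis PowD insert_ident subsetD)
  moreover have "Pow J \<inter> insert x ` Pow J = {}" using assms(2) by blast
  ultimately show ?thesis
    using assms(1) by (simp add: Pow_insert sum.union_disjoint sum.reindex sum.distrib)
qed

text \<open>Induction on \<open>J\<close>: adding the values at \<open>A\<close> and
  \<open>insert x A\<close> turns each function into one on subsets of \<open>J\<close>, and the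
  two-point inequality shows that the hypothesis survives.\<close>

theorem four_functions_Pow:
  fixes \<alpha> \<beta> \<gamma> \<delta> :: "'b set \<Rightarrow> real"
  assumes "finite J"
    and "\<And>A. 0 \<le> \<alpha> A" "\<And>A. 0 \<le> \<beta> A" "\<And>A. 0 \<le> \<gamma> A" "\<And>A. 0 \<le> \<delta> A"
    and "\<And>A B. A \<subseteq> J \<Longrightarrow> B \<subseteq> J \<Longrightarrow> \<alpha> A * \<beta> B \<le> \<gamma> (A \<inter> B) * \<delta> (A \<union> B)"
  shows "sum \<alpha> (Pow J) * sum \<beta> (Pow J) \<le> sum \<gamma> (Pow J) * sum \<delta> (Pow J)"
  using assms
proof (induction J arbitrary: \<alpha> \<beta> \<gamma> \<delta> rule: finite_induct)
  case empty
  then show ?case by force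
next
  case (insert x J)
  note nonneg = insert.prems(1-4) and four = insert.prems(5)
  have "(\<alpha> A + \<alpha> (insert x A)) * (\<beta> B + \<beta> (insert x B))
      \<le> (\<gamma> (A \<inter> B) + \<gamma> (insert x (A \<inter> B))) * (\<delta> (A \<union> B) + \<delta> (insert x (A \<union> B)))"
    if AB: "A \<subseteq> J" "B \<subseteq> J" for A B
  proof (rule four_functions_two_points)
    have x: "x \<notin> A" "x \<notin> B" using AB insert.hyps by auto
    have sub: "A \<subseteq> insert x J" "B \<subseteq> insert x J" "insert x A \<subseteq> insert x J" "insert x B \<subseteq> insert x J"
      using AB by auto
    show "\<alpha> A * \<beta> B \<le> \<gamma> (A \<inter> B) * \<delta> (A \<union> B)"
      using four[OF sub(1,2)] .
    show "\<alpha> A * \<beta> (insert x B) \<le> \<gamma> (A \<inter> B) * \<delta> (insert x (A \<union> B))"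
      using four[OF sub(1,4)] x by simp
    show "\<alpha> (insert x A) * \<beta> B \<le> \<gamma> (A \<inter> B) * \<delta> (insert x (A \<union> B))"
      using four[OF sub(3,2)] x by simp
    show "\<alpha> (insert x A) * \<beta> (insert x B) \<le> \<gamma> (insert x (A \<inter> B)) * \<delta> (insert x (A \<union> B))"
      using four[OF sub(3,4)] by simp
  qed (use nonneg in auto)
  then show ?case
    unfolding sum_Pow_insert[OF insert.hyps]
    by (intro insert.IH) (use nonneg in \<open>auto intro: add_nonneg_nonneg\<close>)
qed

text \<open>The image of \<open>e\<close> is closed under intersection and union. Extending the
  functions by 0 outside it keeps the hypothesis, because the left side vanishes unless both sets
  lie in the image.\<close>

lemma four_functions_ring_of_sets:
  fixes e :: "'i \<Rightarrow> 'b set" and \<alpha> \<beta> \<gamma> \<delta> :: "'i \<Rightarrow> real"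
  assumes J: "finite J" "e ` I \<subseteq> Pow J" and inj: "inj_on e I"
    and nonneg: "\<And>i. i \<in> I \<Longrightarrow> 0 \<le> \<alpha> i" "\<And>i. i \<in> I \<Longrightarrow> 0 \<le> \<beta> i"
      "\<And>i. i \<in> I \<Longrightarrow> 0 \<le> \<gamma> i" "\<And>i. i \<in> I \<Longrightarrow> 0 \<le> \<delta> i"
    and four: "\<And>i j. i \<in> I \<Longrightarrow> j \<in> I \<Longrightarrow> \<exists>m\<in>I. \<exists>n\<in>I.
      e m = e i \<inter> e j \<and> e n = e i \<union> e j \<and> \<alpha> i * \<beta> j \<le> \<gamma> m * \<delta> n"
  shows "sum \<alpha> I * sum \<beta> I \<le> sum \<gamma> I * sum \<delta> I"
proof -
  define ext where "ext f A = (if A \<in> e ` I then f (inv_into I e A) else 0)"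
    for f :: "'i \<Rightarrow> real" and A
  have ext_e: "ext f (e i) = f i" if "i \<in> I" for f i
    unfolding ext_def using that inj by simp
  have sum_ext: "sum (ext f) (Pow J) = sum f I" for f
  proof -
    have "sum (ext f) (Pow J) = sum (ext f) (e ` I)"
      using J by (intro sum.mono_neutral_right) (auto simp: ext_def)
    also have "\<dots> = sum f I"
      using inj by (simp add: sum.reindex ext_e)
    finally show ?thesis .
  qed
  have ext_nonneg: "0 \<le> ext f A" if "\<And>i. i \<in> I \<Longrightarrow> 0 \<le> f i" for f A
    using that unfolding ext_def by (simp add: inv_into_into)
  have "ext \<alpha> A * ext \<beta> B \<le> ext \<gamma> (A \<inter> B) * ext \<delta> (A \<union> B)" for A B
  proof (cases "A \<in> e ` I \<and> B \<in> e ` I")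
    case True
    then obtain i j where ij: "i \<in> I" "j \<in> I" "A = e i" "B = e j" by blast
    obtain m n where "m \<in> I" "n \<in> I" "e m = A \<inter> B" "e n = A \<union> B"
      "\<alpha> i * \<beta> j \<le> \<gamma> m * \<delta> n"
      using four[OF ij(1,2)] ij(3,4) by blast
    then show ?thesis using ij ext_e by metis
  next
    case False
    then have "ext \<alpha> A * ext \<beta> B = 0" by (auto simp: ext_def)
    moreover have "0 \<le> ext \<gamma> (A \<inter> B) * ext \<delta> (A \<union> B)"
      using nonneg by (intro mult_nonneg_nonneg ext_nonneg)
    ultimately show ?thesis by (simp only:)
  qed
  then have "sum (ext \<alpha>) (Pow J) * sum (ext \<beta>) (Pow J) \<le> sum (ext \<gamma>) (Pow J) * sum (ext \<delta>) (Pow J)"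
    using J(1) nonneg by (intro four_functions_Pow ext_nonneg) auto
  then show ?thesis unfolding sum_ext .
qed

text \<open>The four functions are \<open>M * (G + c)\<close>, \<open>M * (H + d)\<close>,
  \<open>M\<close> and \<open>M * (G + c) * (H + d)\<close>. The shifts \<open>c\<close> and
  \<open>d\<close> contribute the same terms to both sides and cancel.\<close>

lemma FKG_ring_of_sets:
  fixes e :: "'i \<Rightarrow> 'b set" and M G H :: "'i \<Rightarrow> real"
  assumes J: "finite J" "e ` I \<subseteq> Pow J" and inj: "inj_on e I"
    and nonneg: "\<And>i. i \<in> I \<Longrightarrow> 0 \<le> M i"
    and M: "\<And>i j. i \<in> I \<Longrightarrow> j \<in> I \<Longrightarrow> \<exists>m\<in>I. \<exists>n\<in>I.
      e m = e i \<inter> e j \<and> e n = e i \<union> e j \<and> M i * M j \<le> M m * M n"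
    and mono: "\<And>i j. i \<in> I \<Longrightarrow> j \<in> I \<Longrightarrow> e i \<subseteq> e j \<Longrightarrow> G i \<le> G j \<and> H i \<le> H j"
  shows "(\<Sum>i\<in>I. M i * G i) * (\<Sum>i\<in>I. M i * H i) \<le> sum M I * (\<Sum>i\<in>I. M i * (G i * H i))"
proof -
  have "finite I"
    using J inj by (metis finite_Pow_iff finite_imageD finite_subset)
  \<comment> \<open>\<open>G\<close> and \<open>H\<close> may be negative; these constants are large
    enough to make both shifted functions nonnegative on \<open>I\<close>.\<close>
  define c d where "c = (\<Sum>i\<in>I. \<bar>G i\<bar>)" and "d = (\<Sum>i\<in>I. \<bar>H i\<bar>)"
  have "\<bar>G i\<bar> \<le> c" "\<bar>H i\<bar> \<le> d" if "i \<in> I" for i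
    unfolding c_def d_def using that \<open>finite I\<close> by (auto intro: member_le_sum)
  then have shift: "0 \<le> G i + c" "0 \<le> H i + d" if "i \<in> I" for i
    using that by fastforce+
  have "(\<Sum>i\<in>I. M i * (G i + c)) * (\<Sum>i\<in>I. M i * (H i + d))
      \<le> sum M I * (\<Sum>i\<in>I. M i * ((G i + c) * (H i + d)))"
  proof (rule four_functions_ring_of_sets[OF J inj])
    fix i j assume ij: "i \<in> I" "j \<in> I"
    then obtain m n where mn: "m \<in> I" "n \<in> I" "e m = e i \<inter> e j" "e n = e i \<union> e j"
      "M i * M j \<le> M m * M n"
      using M by blast
    have "G i \<le> G n" "H j \<le> H n" using mono mn ij by auto
    then have "(M i * M j) * ((G i + c) * (H j + d)) \<le> (M m * M n) * ((G n + c) * (H n + d))"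
      using mn nonneg ij shift
      by (intro mult_mono[of "M i * M j"] mult_mono[of "G i + c"] mult_nonneg_nonneg) auto
    then show "\<exists>m\<in>I. \<exists>n\<in>I. e m = e i \<inter> e j \<and> e n = e i \<union> e j \<and>
        M i * (G i + c) * (M j * (H j + d)) \<le> M m * (M n * ((G n + c) * (H n + d)))"
      using mn by (intro bexI[of _ m] bexI[of _ n]) (auto simp: mult_ac)
  qed (use nonneg shift in auto)
  moreover have "(\<Sum>i\<in>I. M i * (G i + c)) = (\<Sum>i\<in>I. M i * G i) + sum M I * c"
    "(\<Sum>i\<in>I. M i * (H i + d)) = (\<Sum>i\<in>I. M i * H i) + sum M I * d"
    "(\<Sum>i\<in>I. M i * ((G i + c) * (H i + d))) = (\<Sum>i\<in>I. M i * (G i * H i))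
      + (\<Sum>i\<in>I. M i * G i) * d + (\<Sum>i\<in>I. M i * H i) * c + sum M I * (c * d)"
    unfolding sum_distrib_right sum.distrib[symmetric]
    by (auto intro!: sum.cong simp: algebra_simps)
  ultimately show ?thesis by (simp add: algebra_simps)
qed

section \<open>Join-primes and the rank function\<close>

text \<open>The map of Birkhoff's representation. The last conjunct excludes the least element,
  which would satisfy the primality condition trivially.\<close>

definition join_primes_le :: "'a::lattice \<Rightarrow> 'a set" where
  "join_primes_le x =
    {j. j \<le> x \<and> (\<forall>a b. j \<le> sup a b \<longrightarrow> j \<le> a \<or> j \<le> b) \<and> (\<exists>a. \<not> j \<le> a)}"

lemma join_primes_le_inf: "join_primes_le (inf x y) = join_primes_le x \<inter> join_primes_le y"
  unfolding join_primes_le_def by auto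

text \<open>Primality gives the inclusion from left to right.\<close>

lemma join_primes_le_sup: "join_primes_le (sup x y) = join_primes_le x \<union> join_primes_le y"
  unfolding join_primes_le_def by (auto intro: le_supI1 le_supI2)

text \<open>A minimal \<open>j\<close> among the elements below \<open>x\<close> but not below
  \<open>y\<close> is join-prime: if \<open>j\<close> is below \<open>sup a b\<close> but below
  neither \<open>a\<close> nor \<open>b\<close>, its meets with \<open>a\<close> and
  \<open>b\<close> are strictly smaller, hence below \<open>y\<close>, and by distributivity so is
  their join \<open>j\<close>.\<close>

lemma ex_join_prime:
  fixes x y :: "'a::{finite, distrib_lattice}"
  assumes "\<not> x \<le> y"
  shows "\<exists>j \<in> join_primes_le x. \<not> j \<le> y"
proof -
  have "{z. z \<le> x \<and> \<not> z \<le> y} \<noteq> {}" using assms by auto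
  then obtain j where j: "j \<le> x" "\<not> j \<le> y"
    and min: "\<And>z. z \<le> x \<Longrightarrow> \<not> z \<le> y \<Longrightarrow> z \<le> j \<Longrightarrow> z = j"
    using finite_has_minimal[of "{z. z \<le> x \<and> \<not> z \<le> y}"] by auto
  have "j \<le> a \<or> j \<le> b" if "j \<le> sup a b" for a b
  proof (rule ccontr)
    assume "\<not> ?thesis"
    then have "inf j a \<noteq> j" "inf j b \<noteq> j" by (metis inf_le2)+
    then have "inf j a \<le> y" "inf j b \<le> y"
      using min[of "inf j a"] min[of "inf j b"] j(1) by (auto intro: le_infI1)
    moreover have "j = sup (inf j a) (inf j b)"
      using that by (metis inf.absorb1 inf_sup_distrib1)
    ultimately show False using j(2) by (metis sup.bounded_iff)
  qed
  then show ?thesis using j unfolding join_primes_le_def by auto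
qed

lemma join_primes_le_subset_iff:
  fixes x y :: "'a::{finite, distrib_lattice}"
  shows "join_primes_le x \<subseteq> join_primes_le y \<longleftrightarrow> x \<le> y"
proof
  assume "join_primes_le x \<subseteq> join_primes_le y"
  then show "x \<le> y" using ex_join_prime[of x y] unfolding join_primes_le_def by blast
qed (auto simp: join_primes_le_def)

text \<open>Exactly one join-prime is gained. If \<open>i\<close> and \<open>k\<close> are both new,
  then \<open>sup y i = x\<close> by the covering property, so \<open>k \<le> sup y i\<close> and
  primality forces \<open>k \<le> i\<close>; by symmetry \<open>i = k\<close>.\<close>

lemma card_join_primes_le_cover:
  fixes x y :: "'a::{finite, distrib_lattice}"
  assumes "y < x" and cov: "\<forall>z. y \<le> z \<longrightarrow> z \<le> x \<longrightarrow> z = y \<or> z = x"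
  shows "card (join_primes_le x) = Suc (card (join_primes_le y))"
proof -
  obtain j where j: "j \<in> join_primes_le x" "\<not> j \<le> y"
    using ex_join_prime[of x y] assms(1) by (auto simp: less_le_not_le)
  have le: "k \<le> i" if "i \<in> join_primes_le x" "\<not> i \<le> y" "k \<in> join_primes_le x" "\<not> k \<le> y" for i k
  proof -
    have "sup y i = x"
      using cov[rule_format, of "sup y i"] that(1,2) assms(1) unfolding join_primes_le_def
      by (metis (no_types, lifting) le_sup_iff less_imp_le mem_Collect_eq sup_ge1 sup_ge2)
    then have "k \<le> sup y i" using that(3) by (simp add: join_primes_le_def)
    then show ?thesis using that(3,4) unfolding join_primes_le_def by blast
  qed
  have "k = j" if "k \<in> join_primes_le x" "\<not> k \<le> y" for k
    using le[OF j that] le[OF that j] by order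
  moreover have "join_primes_le y \<subseteq> join_primes_le x"
    using assms(1) by (simp add: join_primes_le_subset_iff)
  ultimately have "join_primes_le x = insert j (join_primes_le y)"
    using j(1) unfolding join_primes_le_def by blast
  moreover have "j \<notin> join_primes_le y" using j(2) by (simp add: join_primes_le_def)
  ultimately show ?thesis by simp
qed

text \<open>Each step down a maximal chain is a cover and loses one join-prime, until the least
  element, which has none, is reached.\<close>

lemma card_maxchain_atMost:
  fixes x :: "'a::{finite, distrib_lattice}"
  assumes "pred_on.maxchain {..x} (<) C"
  shows "card C = Suc (card (join_primes_le x))"
  using assms
proof (induction "card C" arbitrary: x C rule: less_induct)
  case less
  show ?case
  proof (cases "C = {x}")
    case True
    \<comment> \<open>A one-element maximal chain forces \<open>x\<close> to be least:
      \<open>inf x a\<close> is comparable with \<open>x\<close>, so it belongs to the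
      chain.\<close>
    have "x \<le> a" for a
    proof -
      have "inf x a \<in> C" using less.prems unfolding maxchain_atMost_iff True by auto
      then show ?thesis using True by (metis inf_le2 singletonD)
    qed
    then have "join_primes_le x = {}"
      unfolding join_primes_le_def by (auto intro: order_trans)
    then show ?thesis using True by simp
  next
    case False
    then obtain y D where "pred_on.maxchain {..y} (<) D" "y < x"
      "\<forall>z. y \<le> z \<longrightarrow> z \<le> x \<longrightarrow> z = y \<or> z = x" "card C = Suc (card D)"
      using maxchain_atMost_cases[OF less.prems] by blast
    then show ?thesis using less.hyps[of D y] card_join_primes_le_cover[of y x] by simp
  qed
qed

lemma lattice_rank_eq_card_join_primes:
  fixes x :: "'a::{finite, distrib_lattice}"
  shows "lattice_rank x = card (join_primes_le x)"
proof -
  obtain C where "pred_on.maxchain {..x} (<) C" using pred_on.Hausdorff by blast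
  then show ?thesis using lattice_rank_eq[of x C] card_maxchain_atMost[of x C] by simp
qed

text \<open>Inclusion-exclusion for the sets of join-primes.\<close>

lemma lattice_rank_modular:
  fixes x y :: "'a::{finite, distrib_lattice}"
  shows "lattice_rank (inf x y) + lattice_rank (sup x y) = lattice_rank x + lattice_rank y"
  unfolding lattice_rank_eq_card_join_primes join_primes_le_inf join_primes_le_sup
  using card_Un_Int[of "join_primes_le x" "join_primes_le y"] by simp

section \<open>Pairs with prescribed meet and join\<close>

text \<open>Distributivity splits \<open>y'\<close> into its meets with \<open>x\<close> and
  \<open>y\<close>, and the first lies below \<open>inf x' y'\<close>. For pairs with common meet
  and join, the second component thus decreases as the first grows, and is determined by it.\<close>

lemma complement_antimono:
  fixes x :: "'a::distrib_lattice"
  assumes "x \<le> x'" "inf x' y' \<le> y" "y' \<le> sup x y"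
  shows "y' \<le> y"
proof -
  have "y' = sup (inf y' x) (inf y' y)"
    using assms(3) by (metis inf.absorb1 inf_sup_distrib1)
  moreover have "inf y' x \<le> y"
    using assms(1,2) by (metis inf.commute inf_mono order_refl order_trans)
  ultimately show ?thesis by (metis inf_le2 sup.bounded_iff)
qed

text \<open>The left side of FKG vanishes, so the total weight times the wanted sum is nonnegative.
  A positive total weight cancels; if it is zero, every weight is zero.\<close>

lemma meet_join_correlation_nonneg:
  fixes \<mu> g h :: "'a::{finite, distrib_lattice} \<Rightarrow> real" and u v :: 'a
  assumes nonneg: "\<And>x. 0 \<le> \<mu> x" and lsm: "log_supermodular \<mu>" and "mono g" "mono h"
  shows "0 \<le> (\<Sum>(x, y) | inf x y = u \<and> sup x y = v. \<mu> x * \<mu> y * ((g x - g y) * (h x - h y)))"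
proof -
  define I where "I = {(x, y). inf x y = u \<and> sup x y = v}"
  define M where "M = (\<lambda>(x, y). \<mu> x * \<mu> y)"
  define G where "G = (\<lambda>(x, y). g x - g y)"
  define H where "H = (\<lambda>(x, y). h x - h y)"
  \<comment> \<open>The first component suffices, since by \<open>complement_antimono\<close> it
    determines the second within \<open>I\<close>.\<close>
  define e where "e p = join_primes_le (fst p)" for p :: "'a \<times> 'a"
  have snd_le: "snd q \<le> snd p" if "p \<in> I" "q \<in> I" "fst p \<le> fst q" for p q
    using that complement_antimono[of "fst p" "fst q" "snd q" "snd p"]
    unfolding I_def by (auto simp: split_beta) (metis sup_ge2)
  have FKG: "(\<Sum>p\<in>I. M p * G p) * (\<Sum>p\<in>I. M p * H p) \<le> sum M I * (\<Sum>p\<in>I. M p * (G p * H p))"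
  proof (rule FKG_ring_of_sets[where J = UNIV and e = e])
    show "inj_on e I"
    proof (rule inj_onI)
      fix p q assume pq: "p \<in> I" "q \<in> I" "e p = e q"
      then have "fst p = fst q"
        unfolding e_def using join_primes_le_subset_iff by (metis order_antisym order_refl)
      then show "p = q" using snd_le[OF pq(1,2)] snd_le[OF pq(2,1)] by (simp add: prod_eq_iff)
    qed
    show "G p \<le> G q \<and> H p \<le> H q" if "p \<in> I" "q \<in> I" "e p \<subseteq> e q" for p q
    proof -
      have "fst p \<le> fst q" using that(3) by (simp add: e_def join_primes_le_subset_iff)
      moreover have "snd q \<le> snd p" using snd_le that(1,2) calculation by blast
      ultimately show ?thesis
        unfolding G_def H_def split_beta using assms(3,4) by (intro conjI diff_mono) (auto dest: monoD)
    qed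
    show "\<exists>m\<in>I. \<exists>n\<in>I. e m = e p \<inter> e q \<and> e n = e p \<union> e q \<and> M p * M q \<le> M m * M n"
      if pq: "p \<in> I" "q \<in> I" for p q
    proof -
      obtain x y x' y' where eq: "p = (x, y)" "q = (x', y')" by (metis surj_pair)
      have uv: "inf x y = u" "sup x y = v" "inf x' y' = u" "sup x' y' = v"
        using pq unfolding I_def eq by auto
      have I1: "inf (inf a a') (sup b b') = u"
        if "inf a b = u" "inf a' b' = u" for a a' b b' :: 'a
      proof -
        have "inf (inf a a') (sup b b') = sup (inf a' (inf a b)) (inf a (inf a' b'))"
          by (simp add: inf_sup_distrib1 inf_left_commute inf_assoc)
        also have "\<dots> = sup (inf a' u) (inf a u)" using that by simp
        also have "\<dots> = u" using that by (metis inf.absorb2 inf_le1 sup.idem)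
        finally show ?thesis .
      qed
      have I2: "sup (sup a a') (inf b b') = v"
        if "sup a b = v" "sup a' b' = v" for a a' b b' :: 'a
      proof -
        have "sup (sup a a') (inf b b') = inf (sup a' (sup a b)) (sup a (sup a' b'))"
          by (simp add: sup_inf_distrib1 sup_left_commute sup_assoc)
        also have "\<dots> = inf (sup a' v) (sup a v)" using that by simp
        also have "\<dots> = v" using that by (metis sup.absorb2 sup_ge1 inf.idem)
        finally show ?thesis .
      qed
      \<comment> \<open>These are the meet and join of \<open>p\<close> and \<open>q\<close>: the
        order is reversed in the second component, so \<open>inf\<close> and \<open>sup\<close>
        trade places there.\<close>
      have "(inf x x', sup y y') \<in> I" "(sup x x', inf y y') \<in> I"
        using I1[of x y x' y'] I1[of y x y' x'] I2[of x y x' y'] I2[of y x y' x'] uv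
        unfolding I_def by (simp_all add: inf_commute sup_commute)
      moreover have "(\<mu> x * \<mu> x') * (\<mu> y * \<mu> y') \<le>
          (\<mu> (inf x x') * \<mu> (sup x x')) * (\<mu> (inf y y') * \<mu> (sup y y'))"
        using lsm nonneg unfolding log_supermodular_def
        by (intro mult_mono[of "\<mu> x * \<mu> x'"] mult_nonneg_nonneg) auto
      then have "M p * M q \<le> M (inf x x', sup y y') * M (sup x x', inf y y')"
        unfolding M_def eq by (simp add: mult_ac)
      ultimately show ?thesis
        unfolding e_def eq
        by (intro bexI[of _ "(inf x x', sup y y')"] bexI[of _ "(sup x x', inf y y')"])
          (simp_all add: join_primes_le_inf join_primes_le_sup)
    qed
  qed (auto simp: M_def nonneg)
  \<comment> \<open>Swapping components permutes \<open>I\<close>, preserves \<open>M\<close> and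
    negates \<open>G\<close>.\<close>
  have "(\<Sum>p\<in>I. M p * G p) = (\<Sum>p\<in>I. - (M p * G p))"
    by (rule sum.reindex_bij_witness[of _ prod.swap prod.swap])
      (auto simp: I_def M_def G_def inf_commute sup_commute algebra_simps)
  then have "(\<Sum>p\<in>I. M p * G p) = 0" by (simp add: sum_negf)
  with FKG have FKG0: "0 \<le> sum M I * (\<Sum>p\<in>I. M p * (G p * H p))" by simp
  have M_nonneg: "0 \<le> M p" for p by (simp add: M_def split_beta nonneg)
  have "0 \<le> (\<Sum>p\<in>I. M p * (G p * H p))"
  proof (cases "sum M I = 0")
    case True
    then have "\<forall>p\<in>I. M p = 0"
      using M_nonneg by (subst (asm) sum_nonneg_eq_0_iff) auto
    then show ?thesis by simp
  next
    case False
    then have "0 < sum M I" using M_nonneg by (simp add: less_le sum_nonneg)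
    then show ?thesis using FKG0 by (simp add: zero_le_mult_iff)
  qed
  then show ?thesis unfolding I_def M_def G_def H_def split_beta .
qed

text \<open>By modularity a pair has the same rank sum as its meet and join, so each fibre of
  \<open>mj\<close> lies inside \<open>S\<close> or misses it.\<close>

lemma rank_correlation_nonneg:
  fixes \<mu> g h :: "'a::{finite, distrib_lattice} \<Rightarrow> real"
  assumes "\<And>x. 0 \<le> \<mu> x" "log_supermodular \<mu>" "mono g" "mono h"
  shows "0 \<le> (\<Sum>(x, y) | lattice_rank x + lattice_rank y = d.
    \<mu> x * \<mu> y * ((g x - g y) * (h x - h y)))"
proof -
  define f where "f = (\<lambda>(x, y). \<mu> x * \<mu> y * ((g x - g y) * (h x - h y)))"
  define S where "S = {(x :: 'a, y :: 'a). lattice_rank x + lattice_rank y = d}"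
  define mj where "mj = (\<lambda>(x :: 'a, y :: 'a). (inf x y, sup x y))"
  have S_mj: "p \<in> S \<longleftrightarrow> mj p \<in> S" for p
    using lattice_rank_modular[of "fst p" "snd p"] by (simp add: S_def mj_def split_beta)
  have "0 \<le> sum f {p \<in> S. mj p = w}" for w
  proof (cases "w \<in> S")
    case True
    then have "{p \<in> S. mj p = w} = {p. mj p = w}" using S_mj by blast
    also have "\<dots> = {(x, y). inf x y = fst w \<and> sup x y = snd w}"
      unfolding mj_def by (auto simp: prod_eq_iff)
    finally have "{p \<in> S. mj p = w} = {(x, y). inf x y = fst w \<and> sup x y = snd w}" .
    then show ?thesis
      using meet_join_correlation_nonneg[OF assms, of "fst w" "snd w"] by (simp add: f_def)
  next
    case False
    then have "{p \<in> S. mj p = w} = {}"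
      using S_mj by auto
    then show ?thesis by (simp only: sum.empty order_refl)
  qed
  then have "0 \<le> (\<Sum>w\<in>UNIV. sum f {p \<in> S. mj p = w})" by (rule sum_nonneg)
  also have "\<dots> = sum f S" by (intro sum.group) auto
  finally show ?thesis unfolding f_def S_def .
qed

section \<open>Coefficients of the products\<close>

lemma coeff_E_poly_mult:
  "coeff (E_poly \<mu> k * E_poly \<mu> l) d =
    (\<Sum>(x, y) | lattice_rank x + lattice_rank y = d. \<mu> x * \<mu> y * (k x * l y))"
proof -
  have "E_poly \<mu> k * E_poly \<mu> l =
      (\<Sum>(x, y)\<in>UNIV. monom (\<mu> x * \<mu> y * (k x * l y)) (lattice_rank x + lattice_rank y))"
    unfolding E_poly_def sum_product sum.cartesian_product
    by (simp add: mult_monom mult_ac)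
  then show ?thesis
    by (simp add: coeff_sum case_prod_unfold sum.If_cases)
qed

lemma coeff_E_poly_mult_swap:
  "coeff (E_poly \<mu> k * E_poly \<mu> l) d =
    (\<Sum>(x, y) | lattice_rank x + lattice_rank y = d. \<mu> x * \<mu> y * (k y * l x))"
  unfolding mult.commute[of "E_poly \<mu> k"] coeff_E_poly_mult by (simp add: mult_ac)

text \<open>Averaging each product with its swapped form symmetrizes the summands, and
  \<open>g x * h x + g y * h y - g x * h y - g y * h x\<close> factors; hence the 2.\<close>

lemma coeff_E_poly_correlation:
  "2 * coeff (E_poly \<mu> (\<lambda>_. 1) * E_poly \<mu> (\<lambda>x. g x * h x) - E_poly \<mu> g * E_poly \<mu> h) d =
    (\<Sum>(x, y) | lattice_rank x + lattice_rank y = d. \<mu> x * \<mu> y * ((g x - g y) * (h x - h y)))"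
proof -
  have double: "2 * coeff (E_poly \<mu> k * E_poly \<mu> l) d =
      (\<Sum>(x, y) | lattice_rank x + lattice_rank y = d. \<mu> x * \<mu> y * (k x * l y + k y * l x))" for k l
    unfolding mult_2
    by (subst (2) coeff_E_poly_mult_swap)
      (simp add: coeff_E_poly_mult split_beta distrib_left flip: sum.distrib)
  show ?thesis
    unfolding coeff_diff right_diff_distrib double sum_subtractf[symmetric] split_beta
    by (intro sum.cong) (auto simp: algebra_simps)
qed

theorem theorem2p1:
  fixes \<mu> g h :: "'a::{finite, distrib_lattice} \<Rightarrow> real"
  assumes "\<And>x. 0 \<le> \<mu> x" and "\<And>x. 0 \<le> g x" and "\<And>x. 0 \<le> h x"
    and "log_supermodular \<mu>"
  shows "(comonotone g h \<longrightarrow>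
            E_poly \<mu> g * E_poly \<mu> h \<lless> E_poly \<mu> (\<lambda>_. 1) * E_poly \<mu> (\<lambda>x. g x * h x)) \<and>
         (countermonotone g h \<longrightarrow>
            E_poly \<mu> (\<lambda>_. 1) * E_poly \<mu> (\<lambda>x. g x * h x) \<lless> E_poly \<mu> g * E_poly \<mu> h)"
proof -
  define c where "c d = (\<Sum>(x, y) | lattice_rank x + lattice_rank y = d.
    \<mu> x * \<mu> y * ((g x - g y) * (h x - h y)))" for d
  note c = coeff_E_poly_correlation[of \<mu> g h, folded c_def]
  note corr = rank_correlation_nonneg[OF assms(1,4)]
  have neg: "mono (\<lambda>x. - k x)" if "antimono k" for k :: "'a \<Rightarrow> real"
    using that by (auto simp: monotone_on_def)
  have "0 \<le> c d" if "comonotone g h" for d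
    using that unfolding comonotone_def
  proof
    assume "antimono g \<and> antimono h"
    \<comment> \<open>Negating both functions makes them increasing and leaves the product of
      differences unchanged.\<close>
    with corr[of "\<lambda>x. - g x" "\<lambda>x. - h x" d] neg show ?thesis
      by (simp add: c_def algebra_simps)
  qed (use corr[of g h d] in \<open>simp add: c_def\<close>)
  moreover have "c d \<le> 0" if "countermonotone g h" for d
  proof -
    \<comment> \<open>Negating the decreasing function makes both increasing and changes the sign of
      the sum; the two equations serve the two cases.\<close>
    have flip: "- c d = (\<Sum>(x, y) | lattice_rank x + lattice_rank y = d.
        \<mu> x * \<mu> y * ((- g x - - g y) * (h x - h y)))"
      "- c d = (\<Sum>(x, y) | lattice_rank x + lattice_rank y = d.
        \<mu> x * \<mu> y * ((g x - g y) * (- h x - - h y)))"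
      unfolding c_def sum_negf[symmetric] split_beta
      by (auto intro!: sum.cong simp: algebra_simps)
    have "0 \<le> - c d"
      using that corr[of g "\<lambda>x. - h x" d] corr[of "\<lambda>x. - g x" h d] neg
      unfolding countermonotone_def flip(1)[symmetric] flip(2)[symmetric] by blast
    then show ?thesis by simp
  qed
  ultimately show ?thesis
    unfolding coeff_le_def coeff_diff using c[unfolded coeff_diff]
    by (smt (verit))
qed

end
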